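(* The Schubert cell $C_w$ of $\mathbb{F}_\omega(E)$ associated to $w\in W(\mathrm{Sp}_{2n+1})$ is the set of flags of isotropic subspaces $V_\bullet=(V_1\subset\cdots\subset V_{n+1})$ of $E$, $\dim V_i=i$, which verify $$\dim(V_{i+1}\cap F_j)=r_w(i,j)$$ for all $0\le i\le n$ and $0\le j\le 2n$.
   Context: $E$ is a complex vector space of dimension $2n+1$ with a skew-form $\omega$ of rank $2n$, contained as a hyperplane in a complex vector space $\tilde E$ of dimension $2n+2$ with a symplectic form $\tilde\omega$ extending $\omega$. Fix a basis $\{e_0,\dots,e_{2n+1}\}$ of $\tilde E$ such that $E=\langle e_0,\dots,e_{2n}\rangle$ and, with $\bar\imath=2n+1-i$, $\tilde\omega(e_i,e_j)=0$ unless $j=\bar\imath$ and $\tilde\omega(e_i,e_{\bar\imath})=1$ for $0\le i\le n$. Put $F_j=\langle e_0,\dots,e_j\rangle$ for $0\le j\le 2n+1$. $\mathbb{F}_\omega(E)$ (resp. $\mathbb{F}_{\tilde\omega}(\tilde E)$) is the variety of flags $(V_1\subset\cdots\subset V_{n+1})$, $\dim V_i=i$, of isotropic subspaces of $E$ (resp. $\tilde E$); $\mathbb{F}_\omega(E)$ is identified with the set of flags in $\mathbb{F}_{\tilde\omega}(\tilde E)$ with $V_{n+1}\subset E$. $W(\mathrm{Sp}_{2n+2})$ is the group of permutations $w$ of $\{0,\dots,2n+1\}$ with $w(\bar\imath)=\overline{w(i)}$; $w$ is written in one-line notation $w(0)w(1)\cdots w(n)$. It is the Weyl group of type $C_{n+1}$,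 with simple reflections $s_i$ ($0\le i\le n-1$) exchanging $i$ with $i+1$ and $\bar\imath$ with $\overline{i+1}$, and $s_n$ exchanging $n$ with $\bar n$, and is equipped with the Bruhat order. $W(\mathrm{Sp}_{2n+1})$ denotes the interval $\{w\in W(\mathrm{Sp}_{2n+2})\mid w\le\bar1\bar2\cdots\bar n0\}$ for the Bruhat order (it is not a group). The rank function of $w$ is $r_w(i,j)=\#\{k\mid 0\le k\le i,\ w(k)\le j\}$, for $0\le i\le n$, $0\le j\le2n+1$. The Schubert cell $C_w$ of $\mathbb{F}_{\tilde\omega}(\tilde E)$, $w\in W(\mathrm{Sp}_{2n+2})$, is the set of flags $V_\bullet\in\mathbb{F}_{\tilde\omega}(\tilde E)$ with $\dim(V_{i+1}\cap F_j)=r_w(i,j)$ for all $0\le i\le n$, $0\le j\le2n+1$. $\mathbb{F}_\omega(E)$ is the Schubert variety $\overline{C_{\bar1\bar2\cdots\bar n0}}=\bigcup_{w\le\bar1\cdots\bar n0}C_w$, and the Schubert cells of $\mathbb{F}_\omega(E)$ are by definition the cells $C_w$ of $\mathbb{F}_{\tilde\omega}(\tilde E)$ contained in it, i.e. those with $w\in W(\mathrm{Sp}_{2n+1})$. *)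

theory Defs
  imports Complex_Main "HOL-Library.FuncSet" "HOL-Combinatorics.Permutations"
begin

definition bar :: "nat \<Rightarrow> nat \<Rightarrow> nat" where
  "bar n i = 2 * n + 1 - i"

definition W_even :: "nat \<Rightarrow> (nat \<Rightarrow> nat) set" where
  "W_even n = {w. w permutes {0..2*n+1} \<and> (\<forall>i\<in>{0..2*n+1}. w (bar n i) = bar n (w i))}"

definition simple_reflection :: "nat \<Rightarrow> nat \<Rightarrow> nat \<Rightarrow> nat" where
  "simple_reflection n i =
     (if i < n then transpose i (i + 1) \<circ> transpose (bar n i) (bar n (i + 1))
      else transpose n (bar n n))"

definition word_prod :: "nat \<Rightarrow> nat list \<Rightarrow> nat \<Rightarrow> nat" where
  "word_prod n is = foldr (\<lambda>i u. simple_reflection n i \<circ> u) is id"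

definition weyl_length :: "nat \<Rightarrow> (nat \<Rightarrow> nat) \<Rightarrow> nat" where
  "weyl_length n w = (LEAST k. \<exists>is. length is = k \<and> set is \<subseteq> {0..n} \<and> word_prod n is = w)"

definition reflections :: "nat \<Rightarrow> (nat \<Rightarrow> nat) set" where
  "reflections n = {u \<circ> simple_reflection n i \<circ> inv u |u i. u \<in> W_even n \<and> i \<le> n}"

definition bruhat_step :: "nat \<Rightarrow> (nat \<Rightarrow> nat) \<Rightarrow> (nat \<Rightarrow> nat) \<Rightarrow> bool" where
  "bruhat_step n u v \<longleftrightarrow> u \<in> W_even n \<and> v \<in> W_even n \<and>
     (\<exists>t\<in>reflections n. v = u \<circ> t) \<and> weyl_length n u < weyl_length n v"

definition bruhat_le :: "nat \<Rightarrow> (nat \<Rightarrow> nat) \<Rightarrow> (nat \<Rightarrow> nat) \<Rightarrow> bool" where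
  "bruhat_le n = (bruhat_step n)\<^sup>*\<^sup>*"

text \<open>The permutation with one-line notation \<open>a 0, \<dots>, a n\<close>; its remaining values are forced
  by compatibility with the bar involution.\<close>

definition of_one_line :: "nat \<Rightarrow> (nat \<Rightarrow> nat) \<Rightarrow> nat \<Rightarrow> nat" where
  "of_one_line n a i =
     (if i \<le> n then a i else if i \<le> 2 * n + 1 then bar n (a (bar n i)) else i)"

definition w_top :: "nat \<Rightarrow> nat \<Rightarrow> nat" where
  "w_top n = of_one_line n (\<lambda>i. if i < n then bar n (i + 1) else 0)"

definition W_odd :: "nat \<Rightarrow> (nat \<Rightarrow> nat) set" where
  "W_odd n = {w \<in> W_even n. bruhat_le n w (w_top n)}"

definition rank_fun :: "(nat \<Rightarrow> nat) \<Rightarrow> nat \<Rightarrow> nat \<Rightarrow> nat" where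
  "rank_fun w i j = card {k. k \<le> i \<and> w k \<le> j}"

definition bilinear_on ::
    "(complex \<Rightarrow> 'a::ab_group_add \<Rightarrow> 'a) \<Rightarrow> 'a set \<Rightarrow> ('a \<Rightarrow> 'a \<Rightarrow> complex) \<Rightarrow> bool" where
  "bilinear_on scale U B \<longleftrightarrow>
     (\<forall>x\<in>U. \<forall>y\<in>U. \<forall>z\<in>U. B (x + y) z = B x z + B y z \<and> B z (x + y) = B z x + B z y) \<and>
     (\<forall>c. \<forall>x\<in>U. \<forall>y\<in>U. B (scale c x) y = c * B x y \<and> B x (scale c y) = c * B x y)"

definition skew_form_on ::
    "(complex \<Rightarrow> 'a::ab_group_add \<Rightarrow> 'a) \<Rightarrow> 'a set \<Rightarrow> ('a \<Rightarrow> 'a \<Rightarrow> complex) \<Rightarrow> bool" where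
  "skew_form_on scale U B \<longleftrightarrow> bilinear_on scale U B \<and> (\<forall>x\<in>U. \<forall>y\<in>U. B x y = - B y x)"

definition form_kernel :: "'a set \<Rightarrow> ('a \<Rightarrow> 'a \<Rightarrow> complex) \<Rightarrow> 'a set" where
  "form_kernel U B = {x \<in> U. \<forall>y\<in>U. B x y = 0}"

text \<open>The rank of a form is the codimension of its kernel.\<close>

definition form_rank ::
    "(complex \<Rightarrow> 'a::ab_group_add \<Rightarrow> 'a) \<Rightarrow> 'a set \<Rightarrow> ('a \<Rightarrow> 'a \<Rightarrow> complex) \<Rightarrow> nat" where
  "form_rank scale U B = vector_space.dim scale U - vector_space.dim scale (form_kernel U B)"

definition symplectic_form_on ::
    "(complex \<Rightarrow> 'a::ab_group_add \<Rightarrow> 'a) \<Rightarrow> 'a set \<Rightarrow> ('a \<Rightarrow> 'a \<Rightarrow> complex) \<Rightarrow> bool" where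
  "symplectic_form_on scale U B \<longleftrightarrow> skew_form_on scale U B \<and> form_kernel U B = {0}"

definition isotropic :: "('a \<Rightarrow> 'a \<Rightarrow> complex) \<Rightarrow> 'a set \<Rightarrow> bool" where
  "isotropic B S \<longleftrightarrow> (\<forall>x\<in>S. \<forall>y\<in>S. B x y = 0)"

text \<open>A flag \<open>V\<^sub>1 \<subset> \<dots> \<subset> V\<^sub>m\<close> is a function with extensional domain \<open>{1..m}\<close>.\<close>

definition isotropic_flags ::
    "(complex \<Rightarrow> 'a::ab_group_add \<Rightarrow> 'a) \<Rightarrow> 'a set \<Rightarrow> ('a \<Rightarrow> 'a \<Rightarrow> complex) \<Rightarrow> nat
      \<Rightarrow> (nat \<Rightarrow> 'a set) set" where
  "isotropic_flags scale U B m =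
     {V \<in> {1..m} \<rightarrow>\<^sub>E {S. module.subspace scale S \<and> S \<subseteq> U \<and> isotropic B S}.
        (\<forall>i\<in>{1..m}. vector_space.dim scale (V i) = i) \<and>
        (\<forall>i\<in>{1..<m}. V i \<subseteq> V (i + 1))}"

text \<open>The type \<open>'a\<close> itself is the ambient symplectic space of dimension \<open>2n + 2\<close>, with form \<open>\<Omega>\<close>.
  The values of \<open>\<omega>\<close> matter on \<open>E\<close> only.\<close>

locale odd_symplectic = vector_space scale
  for scale :: "complex \<Rightarrow> 'a::ab_group_add \<Rightarrow> 'a" +
  fixes n :: nat
    and E :: "'a set" and \<omega> :: "'a \<Rightarrow> 'a \<Rightarrow> complex"
    and \<Omega> :: "'a \<Rightarrow> 'a \<Rightarrow> complex"
    and e :: "nat \<Rightarrow> 'a"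
  assumes dim_ambient: "dim (UNIV :: 'a set) = 2 * n + 2"
    and symplectic: "symplectic_form_on scale UNIV \<Omega>"
    and subspace_E: "subspace E"
    and dim_E: "dim E = 2 * n + 1"
    and skew_E: "skew_form_on scale E \<omega>"
    and rank_E: "form_rank scale E \<omega> = 2 * n"
    and extends: "\<And>x y. x \<in> E \<Longrightarrow> y \<in> E \<Longrightarrow> \<Omega> x y = \<omega> x y"
    and basis_inj: "inj_on e {0..2*n+1}"
    and basis_independent: "independent (e ` {0..2*n+1})"
    and basis_span: "span (e ` {0..2*n+1}) = UNIV"
    and E_eq: "E = span (e ` {0..2*n})"
    and form_basis_0: "\<And>i j. i \<le> 2 * n + 1 \<Longrightarrow> j \<le> 2 * n + 1 \<Longrightarrow> j \<noteq> bar n i \<Longrightarrow> \<Omega> (e i) (e j) = 0"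
    and form_basis_1: "\<And>i. i \<le> n \<Longrightarrow> \<Omega> (e i) (e (bar n i)) = 1"

definition std_flag ::
    "(complex \<Rightarrow> 'a::ab_group_add \<Rightarrow> 'a) \<Rightarrow> (nat \<Rightarrow> 'a) \<Rightarrow> nat \<Rightarrow> 'a set" where
  "std_flag scale e j = module.span scale (e ` {0..j})"

text \<open>The Schubert cell of the symplectic flag variety of the ambient space attached to
  \<open>w \<in> W_even n\<close>. The Schubert cells of the odd symplectic flag variety are, by definition,
  those with \<open>w \<in> W_odd n\<close>.\<close>

definition schubert_cell ::
    "(complex \<Rightarrow> 'a::ab_group_add \<Rightarrow> 'a) \<Rightarrow> nat \<Rightarrow> ('a \<Rightarrow> 'a \<Rightarrow> complex) \<Rightarrow> (nat \<Rightarrow> 'a)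
      \<Rightarrow> (nat \<Rightarrow> nat) \<Rightarrow> (nat \<Rightarrow> 'a set) set" where
  "schubert_cell scale n \<Omega> e w =
     {V \<in> isotropic_flags scale UNIV \<Omega> (n + 1).
        \<forall>i\<in>{0..n}. \<forall>j\<in>{0..2*n+1}.
          vector_space.dim scale (V (i + 1) \<inter> std_flag scale e j) = rank_fun w i j}"

end

theory Submission
  imports Defs
begin

text \<open>
The two descriptions differ in two ways: flags in \<open>E\<close> are flags in the ambient space with
\<open>V (n + 1) \<subseteq> E\<close>, and the conditions with \<open>j = 2*n+1\<close> are left out. Since \<open>std_flag scale e (2*n+1)\<close>
is everything, the omitted conditions say \<open>i + 1 = rank_fun w i (2*n+1)\<close>, which holds because no
value of \<open>w\<close> at a position \<open>\<le> n\<close> exceeds \<open>2*n+1\<close>. Since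
\<open>std_flag scale e (2*n)\<close> is \<open>E\<close>, the condition at \<open>(n, 2*n)\<close> says that \<open>V (n + 1)\<close> meets \<open>E\<close> in
dimension \<open>rank_fun w n (2*n)\<close>. What is needed is thus a combinatorial fact, \<open>W_odd_le\<close>:
an element of the interval never takes the value \<open>2*n+1\<close> on \<open>0, \<dots>, n\<close>. Then
\<open>rank_fun w n (2*n) = n + 1\<close>, which forces \<open>V (n + 1) \<subseteq> E\<close>.

By the bar symmetry this fact is equivalent to the value \<open>0\<close> being taken at a position \<open>\<le> n\<close>.
This holds for the top element and is inherited downwards along the Bruhat order: if
\<open>v = u \<circ> t\<close> has \<open>v q = 0\<close> with \<open>q \<le> n\<close> but \<open>u\<close> took the value \<open>0\<close> only at \<open>t q > n\<close>, then
\<open>u\<close> would have an inversion at the positions \<open>q < t q\<close>, and undoing an inversion by a reflection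
shortens an element (\<open>weyl_length_reflection_less\<close>), so \<open>v\<close> could not lie above \<open>u\<close>.
The shortening is the strong exchange property (\<open>strong_exchange\<close>), proved by deleting the letter
of a word at which the inversion is created. Applying it to a reduced word requires that the
simple reflections generate the group (\<open>word_exists\<close>).
\<close>

section \<open>Signed permutations and their reflections\<close>

lemma bar_bar: "i \<le> 2*n+1 \<Longrightarrow> bar n (bar n i) = i"
  by (simp add: bar_def)

lemma bar_le: "bar n i \<le> 2*n+1"
  by (simp add: bar_def)

lemma bar_eq_iff:
  "i \<le> 2*n+1 \<Longrightarrow> j \<le> 2*n+1 \<Longrightarrow> bar n i = bar n j \<longleftrightarrow> i = j"
  by (auto simp: bar_def)

lemma bar_eq_swap:
  "i \<le> 2*n+1 \<Longrightarrow> j \<le> 2*n+1 \<Longrightarrow> bar n i = j \<longleftrightarrow> i = bar n j"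
  by (auto simp: bar_def)

lemma bar_neq: "bar n i \<noteq> i"
  unfolding bar_def by presburger

lemma W_even_bar: "w \<in> W_even n \<Longrightarrow> i \<le> 2*n+1 \<Longrightarrow> w (bar n i) = bar n (w i)"
  by (auto simp: W_even_def)

lemma W_even_permutes: "w \<in> W_even n \<Longrightarrow> w permutes {0..2*n+1}"
  by (simp add: W_even_def)

lemma W_even_le: "w \<in> W_even n \<Longrightarrow> i \<le> 2*n+1 \<Longrightarrow> w i \<le> 2*n+1"
  using permutes_in_image[OF W_even_permutes] by fastforce

lemma W_even_eq_iff: "w \<in> W_even n \<Longrightarrow> w i = w j \<longleftrightarrow> i = j"
  by (rule inj_eq[OF permutes_inj[OF W_even_permutes]])

lemma W_even_id: "id \<in> W_even n"
  by (simp add: W_even_def permutes_id)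

lemma W_even_comp: "u \<in> W_even n \<Longrightarrow> v \<in> W_even n \<Longrightarrow> u \<circ> v \<in> W_even n"
  unfolding W_even_def
  by (auto simp: permutes_compose) (metis atLeastAtMost_iff permutes_in_image zero_le)

text \<open>The exchange of \<open>a\<close> with \<open>b\<close> and of \<open>bar n a\<close> with \<open>bar n b\<close>. The nested conditionals also cover
the long-root case \<open>b = bar n a\<close>, where the two exchanges coincide, so that simple reflections and
their conjugates all have this one form.\<close>

definition swap_pair :: "nat \<Rightarrow> nat \<Rightarrow> nat \<Rightarrow> nat \<Rightarrow> nat" where
  "swap_pair n a b k =
     (if k = a then b else if k = b then a
      else if k = bar n a then bar n b else if k = bar n b then bar n a else k)"

lemma swap_pair_involution:
  assumes "a \<le> 2*n+1" "b \<le> 2*n+1"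
  shows "swap_pair n a b (swap_pair n a b k) = k"
  using assms bar_neq[of n a] bar_neq[of n b] by (auto simp: swap_pair_def bar_bar bar_eq_iff)

lemma swap_pair_W_even:
  assumes ab: "a \<le> 2*n+1" "b \<le> 2*n+1"
  shows "swap_pair n a b \<in> W_even n"
proof -
  have "bij (swap_pair n a b)"
    by (rule o_bij[of "swap_pair n a b"]) (use swap_pair_involution[OF ab] in auto)
  moreover have "swap_pair n a b k = k" if "k \<notin> {0..2*n+1}" for k
    using that ab bar_le[of n a] bar_le[of n b] by (auto simp: swap_pair_def)
  ultimately have "swap_pair n a b permutes {0..2*n+1}"
    by (simp add: permutes_def bij_iff)
  moreover have "swap_pair n a b (bar n k) = bar n (swap_pair n a b k)" if "k \<le> 2*n+1" for k
    using that ab bar_neq[of n a] bar_neq[of n b]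
    by (simp add: swap_pair_def bar_eq_swap bar_eq_iff bar_bar bar_le)
  ultimately show ?thesis by (simp add: W_even_def)
qed

lemma simple_reflection_eq_swap_pair:
  assumes "i \<le> n" shows "simple_reflection n i = swap_pair n i (i + 1)"
  using assms
  by (auto simp: fun_eq_iff simple_reflection_def swap_pair_def bar_def transpose_def)

lemma swap_pair_conj:
  assumes u: "u \<in> W_even n" and ab: "a \<le> 2*n+1" "b \<le> 2*n+1"
  shows "u \<circ> swap_pair n a b = swap_pair n (u a) (u b) \<circ> u"
  using ab
  by (auto simp: fun_eq_iff swap_pair_def W_even_eq_iff[OF u] simp flip: W_even_bar[OF u])

lemma swap_pair_commute: "swap_pair n b a = swap_pair n a b"
  by (auto simp: fun_eq_iff swap_pair_def)

lemma swap_pair_bar: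
  assumes "a \<le> 2*n+1" "b \<le> 2*n+1"
  shows "swap_pair n (bar n a) (bar n b) = swap_pair n a b"
  using assms bar_neq[of n a] bar_neq[of n b]
  by (auto simp: fun_eq_iff swap_pair_def bar_bar)

text \<open>A swap is determined by what it does to any single point that it moves; this identifies a
reflection from one known value.\<close>

lemma swap_pair_eq_of_moved:
  assumes ab: "a \<le> 2*n+1" "b \<le> 2*n+1" and q: "swap_pair n a b q \<noteq> q"
  shows "swap_pair n a b = swap_pair n q (swap_pair n a b q)"
proof -
  consider "q = a" "swap_pair n a b q = b" | "q = b" "swap_pair n a b q = a"
    | "q = bar n a" "swap_pair n a b q = bar n b" | "q = bar n b" "swap_pair n a b q = bar n a"
    using q unfolding swap_pair_def by metis
  then show ?thesis
    by cases (metis swap_pair_commute swap_pair_bar[OF ab])+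
qed

lemma reflections_eq_swap_pair:
  assumes t: "t \<in> reflections n" and q: "t q \<noteq> q"
  shows "q \<le> 2*n+1" "t q \<le> 2*n+1" "t = swap_pair n q (t q)"
proof -
  obtain u i where u: "u \<in> W_even n" and i: "i \<le> n"
    and t_eq: "t = u \<circ> simple_reflection n i \<circ> inv u"
    using t by (auto simp: reflections_def)
  define a b where "a = u i" and "b = u (i + 1)"
  have ab: "a \<le> 2*n+1" "b \<le> 2*n+1"
    using i unfolding a_def b_def by (intro W_even_le[OF u]; simp)+
  have "t = swap_pair n a b \<circ> (u \<circ> inv u)"
    using i unfolding t_eq a_def b_def
    by (simp add: simple_reflection_eq_swap_pair swap_pair_conj[OF u] comp_assoc)
  also have "u \<circ> inv u = id"
    by (rule permutes_inv_o(1)[OF W_even_permutes[OF u]])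
  finally have tab: "t = swap_pair n a b" by simp
  show "t = swap_pair n q (t q)"
    using swap_pair_eq_of_moved[OF ab] q unfolding tab by blast
  have tW: "t permutes {0..2*n+1}"
    unfolding tab by (rule W_even_permutes[OF swap_pair_W_even[OF ab]])
  show "q \<le> 2*n+1"
    using permutes_not_in[OF tW] q by fastforce
  then show "t q \<le> 2*n+1"
    using permutes_in_image[OF tW, of q] by simp
qed

section \<open>Reduced words and inversions\<close>

lemma word_prod_Nil: "word_prod n [] = id"
  and word_prod_Cons: "word_prod n (i # ws) = simple_reflection n i \<circ> word_prod n ws"
  by (simp_all add: word_prod_def)

lemma word_prod_snoc: "word_prod n (ws @ [i]) = word_prod n ws \<circ> simple_reflection n i"
  by (induction ws) (simp_all add: word_prod_Nil word_prod_Cons comp_assoc)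

lemma word_prod_W_even: "set ws \<subseteq> {0..n} \<Longrightarrow> word_prod n ws \<in> W_even n"
  by (induction ws)
    (auto simp: word_prod_Nil word_prod_Cons W_even_id simple_reflection_eq_swap_pair
        intro!: W_even_comp swap_pair_W_even)

text \<open>A simple reflection moves every number by at most one, so it can only invert a pair of
neighbours that it exchanges.\<close>

lemma simple_reflection_inverts_only_moved:
  assumes i: "i \<le> n" and ab: "a < b" "simple_reflection n i b < simple_reflection n i a"
  shows "simple_reflection n i a = b"
proof -
  have "simple_reflection n i k \<le> k + 1 \<and> k \<le> simple_reflection n i k + 1" for k
    using i unfolding simple_reflection_eq_swap_pair[OF i] swap_pair_def by (auto simp: bar_def)
  from this[of a] this[of b] show ?thesis using ab by linarith
qed

text \<open>
Reading the word from its right end, the pair of positions \<open>q < p\<close> starts out in order and ends up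
inverted, so some letter \<open>i\<close> inverts it. That letter exchanges the two values that the part \<open>u\<close> of the
word to its right has at \<open>q\<close> and \<open>p\<close>, hence \<open>simple_reflection n i \<circ> u = u \<circ> swap_pair n q p\<close>, and
multiplying by the swap on the right cancels the letter.
\<close>

lemma strong_exchange:
  assumes "set ws \<subseteq> {0..n}" and "q < p" "p \<le> 2*n+1"
    and "word_prod n ws p < word_prod n ws q"
  shows "\<exists>js. set js \<subseteq> {0..n} \<and> Suc (length js) = length ws \<and>
           word_prod n js = word_prod n ws \<circ> swap_pair n q p"
  using assms(1,4)
proof (induction ws)
  case Nil
  then show ?case using \<open>q < p\<close> by (simp add: word_prod_Nil)
next
  case (Cons i ws)
  define u where "u = word_prod n ws"
  have i: "i \<le> n" and ws_le: "set ws \<subseteq> {0..n}" using Cons.prems by auto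
  have u: "u \<in> W_even n" unfolding u_def by (rule word_prod_W_even[OF ws_le])
  have q: "q \<le> 2*n+1" using assms(2,3) by simp
  consider "u p < u q" | "u q < u p"
    using W_even_eq_iff[OF u, of p q] \<open>q < p\<close> by linarith
  then show ?case
  proof cases
    case 1
    then obtain js where js: "set js \<subseteq> {0..n}" "Suc (length js) = length ws"
        "word_prod n js = u \<circ> swap_pair n q p"
      using Cons.IH[OF ws_le] unfolding u_def by blast
    then show ?thesis
      using i by (intro exI[of _ "i # js"]) (auto simp: word_prod_Cons comp_assoc u_def)
  next
    case 2
    have "simple_reflection n i (u q) = u p"
      using simple_reflection_inverts_only_moved[OF i 2] Cons.prems(2)
      by (simp add: word_prod_Cons u_def)
    then have s: "simple_reflection n i = swap_pair n (u q) (u p)"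
      using swap_pair_eq_of_moved[of i n "i + 1" "u q"] 2 i
      by (simp add: simple_reflection_eq_swap_pair)
    have "word_prod n (i # ws) \<circ> swap_pair n q p
        = simple_reflection n i \<circ> (u \<circ> swap_pair n q p)"
      by (simp add: word_prod_Cons comp_assoc u_def)
    also have "\<dots> = simple_reflection n i \<circ> (simple_reflection n i \<circ> u)"
      unfolding swap_pair_conj[OF u q assms(3)] s ..
    also have "\<dots> = u"
      using swap_pair_involution[of i n "i+1"] i
      by (simp add: fun_eq_iff simple_reflection_eq_swap_pair)
    finally show ?thesis
      using ws_le by (intro exI[of _ ws]) (simp add: u_def)
  qed
qed

text \<open>The rearrangement inequality for a single exchange: removing an inversion moves the larger value to
the larger weight.\<close>

lemma sum_weighted_transpose_less:
  fixes u :: "nat \<Rightarrow> nat"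
  assumes "finite A" "a \<in> A" "b \<in> A" "a < b" "u b < u a"
  shows "(\<Sum>k\<in>A. k * u k) < (\<Sum>k\<in>A. k * u (transpose a b k))"
proof -
  have split: "sum f A = f a + f b + sum f (A - {a, b})" for f :: "nat \<Rightarrow> nat"
    using assms sum.subset_diff[of "{a, b}" A f] by simp
  have "(\<Sum>k\<in>A - {a, b}. k * u (transpose a b k)) = (\<Sum>k\<in>A - {a, b}. k * u k)"
    by (intro sum.cong) (auto simp: transpose_def)
  moreover have "a * u a + b * u b < a * u b + b * u a"
  proof -
    obtain c d where "b = a + Suc c" "u a = u b + Suc d"
      using assms less_imp_Suc_add by (metis add_Suc_right)
    then show ?thesis by (simp add: algebra_simps)
  qed
  ultimately show ?thesis
    unfolding split[of "\<lambda>k. k * u k"] split[of "\<lambda>k. k * u (transpose a b k)"]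
    using assms by simp
qed

text \<open>The ascents at \<open>0, \<dots>, n\<close> are carried by the bar symmetry to the other half of the positions, so \<open>u\<close> is
an increasing permutation.\<close>

lemma W_even_eq_id:
  assumes u: "u \<in> W_even n" and asc: "\<And>i. i \<le> n \<Longrightarrow> u i < u (i + 1)"
  shows "u = id"
proof -
  have step: "u i < u (i + 1)" if "i \<le> 2*n" for i
  proof (cases "i \<le> n")
    case False
    define j where "j = bar n (i + 1)"
    have j: "j \<le> n" "i + 1 = bar n j" "i = bar n (j + 1)"
      using False that by (auto simp: j_def bar_def)
    have "u i = bar n (u (j + 1))" "u (i + 1) = bar n (u j)"
      using j W_even_bar[OF u, of "j + 1"] W_even_bar[OF u, of j] by simp_all
    moreover have "u (j + 1) \<le> 2*n+1" using j by (intro W_even_le[OF u]) simp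
    ultimately show ?thesis
      using asc[OF j(1)] by (simp add: bar_def)
  qed (use asc in blast)
  have lower: "i \<le> 2*n+1 \<Longrightarrow> i \<le> u i" for i
  proof (induction i)
    case (Suc i)
    then show ?case using step[of i] by simp
  qed simp
  have "i \<le> 2*n+1 \<Longrightarrow> u i = i" for i
    using lower[of i] lower[of "bar n i"] W_even_bar[OF u, of i] W_even_le[OF u, of i] bar_le[of n i]
    by (simp add: bar_def)
  moreover have "\<not> i \<le> 2*n+1 \<Longrightarrow> u i = i" for i
    using permutes_not_in[OF W_even_permutes[OF u]] by simp
  ultimately show ?thesis by (auto simp: fun_eq_iff)
qed

text \<open>As long as some simple reflection removes a descent of \<open>u\<close>, multiplying by it on the right
increases the bounded quantity \<open>\<Sum>k. k * u k\<close>; without descents, \<open>u\<close> is the identity.\<close>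

lemma word_exists:
  assumes "u \<in> W_even n"
  shows "\<exists>ws. set ws \<subseteq> {0..n} \<and> word_prod n ws = u"
proof -
  define N where "N = (\<Sum>k\<in>{0..2*n+1}. k * (2*n+1))"
  define m where "m u = (\<Sum>k\<in>{0..2*n+1}. k * u k)" for u :: "nat \<Rightarrow> nat"
  have bound: "m u \<le> N" if "u \<in> W_even n" for u
    unfolding m_def N_def using W_even_le[OF that] by (intro sum_mono mult_le_mono2) auto
  show ?thesis
    using assms
  proof (induction "N - m u" arbitrary: u rule: less_induct)
    case less
    show ?case
    proof (cases "\<exists>i\<le>n. u (i + 1) < u i")
      case False
      then have "u i < u (i + 1)" if "i \<le> n" for i
        using that W_even_eq_iff[OF less.prems, of i "i + 1"] by (metis less_add_one linorder_neqE_nat nat_less_le)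
      then have "u = id" by (rule W_even_eq_id[OF less.prems])
      then show ?thesis by (intro exI[of _ "[]"]) (simp add: word_prod_Nil)
    next
      case True
      then obtain i where i: "i \<le> n" "u (i + 1) < u i" by blast
      define s where "s = simple_reflection n i"
      have s: "s \<in> W_even n" "s \<circ> s = id"
        using i swap_pair_involution[of i n "i + 1"]
        by (auto simp: s_def simple_reflection_eq_swap_pair fun_eq_iff intro!: swap_pair_W_even)
      have us: "u \<circ> s \<in> W_even n" by (rule W_even_comp[OF less.prems s(1)])
      have "m u < m (u \<circ> s)"
      proof (cases "i = n")
        case True
        then show ?thesis
          using i sum_weighted_transpose_less[of "{0..2*n+1}" n "n + 1" u]
          by (simp add: m_def s_def simple_reflection_def bar_def)
      next
        case False
        \<comment> \<open>The two exchanges that make up \<open>s\<close> each remove an inversion; the second is the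
          mirror image of the first.\<close>
        define v where "v = u \<circ> transpose i (i + 1)"
        have "m u < m v"
          using i sum_weighted_transpose_less[of "{0..2*n+1}" i "i + 1" u]
          by (simp add: m_def v_def)
        also have "m v < m (v \<circ> transpose (bar n (i + 1)) (bar n i))"
        proof -
          have "v (bar n (i + 1)) = bar n (u (i + 1))" "v (bar n i) = bar n (u i)"
            using i False W_even_bar[OF less.prems, of i] W_even_bar[OF less.prems, of "i + 1"]
            by (auto simp: v_def transpose_def bar_def)
          moreover have "bar n (u i) < bar n (u (i + 1))"
            using i W_even_le[OF less.prems, of i] by (simp add: bar_def)
          ultimately show ?thesis
            using i sum_weighted_transpose_less[of "{0..2*n+1}" "bar n (i + 1)" "bar n i" v]
            by (simp add: m_def bar_def)
        qed
        finally show ?thesis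
          using i False by (simp add: v_def s_def simple_reflection_def comp_assoc transpose_commute)
      qed
      then obtain ws where "set ws \<subseteq> {0..n}" "word_prod n ws = u \<circ> s"
        using less.hyps[OF _ us] bound[OF us] by (metis diff_less_mono2 order_less_le_trans)
      then show ?thesis
        using i s(2) by (intro exI[of _ "ws @ [i]"]) (auto simp: word_prod_snoc comp_assoc simp flip: s_def)
    qed
  qed
qed

lemma weyl_length_le: "set ws \<subseteq> {0..n} \<Longrightarrow> weyl_length n (word_prod n ws) \<le> length ws"
  unfolding weyl_length_def by (rule Least_le) blast

lemma reduced_word_exists:
  assumes "u \<in> W_even n"
  shows "\<exists>ws. set ws \<subseteq> {0..n} \<and> word_prod n ws = u \<and> length ws = weyl_length n u"
proof -
  have "\<exists>k ws. length ws = k \<and> set ws \<subseteq> {0..n} \<and> word_prod n ws = u"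
    using word_exists[OF assms] by blast
  from LeastI_ex[OF this] show ?thesis unfolding weyl_length_def by blast
qed

text \<open>Strong exchange applied to a reduced word of \<open>u\<close> gives a word of \<open>u \<circ> t\<close> with one letter less.\<close>

lemma weyl_length_reflection_less:
  assumes u: "u \<in> W_even n" and t: "t \<in> reflections n"
    and inv: "q < t q" "u (t q) < u q"
  shows "weyl_length n (u \<circ> t) < weyl_length n u"
proof -
  have "t q \<noteq> q" using inv by simp
  note t = reflections_eq_swap_pair[OF t this]
  obtain ws where ws: "set ws \<subseteq> {0..n}" "word_prod n ws = u" "length ws = weyl_length n u"
    using reduced_word_exists[OF u] by blast
  obtain js where js: "set js \<subseteq> {0..n}" "Suc (length js) = length ws"
      "word_prod n js = u \<circ> t"
    using strong_exchange[OF ws(1) inv(1) t(2)] inv(2) unfolding ws(2) t(3)[symmetric] by blast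
  show ?thesis
    using weyl_length_le[OF js(1)] js ws by simp
qed

section \<open>The interval below the top element\<close>

text \<open>The value \<open>0\<close> is smaller than every other, so a reflection that brings it from a position \<open>> n\<close> to a
position \<open>\<le> n\<close> removes an inversion and makes the element shorter: going up in the Bruhat order
never does this.\<close>

lemma bruhat_step_zero_position:
  assumes st: "bruhat_step n u v" and v: "\<exists>q\<le>n. v q = 0"
  shows "\<exists>q\<le>n. u q = 0"
proof -
  obtain t where u: "u \<in> W_even n" and t: "t \<in> reflections n" and vt: "v = u \<circ> t"
    and len: "weyl_length n u < weyl_length n v"
    using st by (auto simp: bruhat_step_def)
  obtain q where q: "q \<le> n" "u (t q) = 0" using v vt by auto
  have "t q \<le> n"
  proof (rule ccontr)
    assume "\<not> t q \<le> n"
    then have "q < t q" using q by simp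
    moreover have "u (t q) < u q"
      using q(2) W_even_eq_iff[OF u, of q "t q"] \<open>q < t q\<close> by (cases "u q") auto
    ultimately have "weyl_length n v < weyl_length n u"
      unfolding vt by (rule weyl_length_reflection_less[OF u t])
    with len show False by simp
  qed
  then show ?thesis using q by blast
qed

lemma W_odd_zero_position:
  assumes "w \<in> W_odd n" shows "\<exists>q\<le>n. w q = 0"
proof -
  have "bruhat_le n w (w_top n)" using assms by (simp add: W_odd_def)
  then show ?thesis
    unfolding bruhat_le_def
  proof (induction rule: converse_rtranclp_induct)
    case base
    show ?case by (intro exI[of _ n]) (simp add: w_top_def of_one_line_def)
  next
    case (step u v)
    then show ?case using bruhat_step_zero_position by blast
  qed
qed

text \<open>If \<open>0\<close> sits at a position \<open>q \<le> n\<close>, then its mirror value \<open>2*n+1\<close> sits at \<open>bar n q > n\<close>.\<close>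

lemma W_odd_le:
  assumes w: "w \<in> W_odd n" and k: "k \<le> n"
  shows "w k \<le> 2*n"
proof -
  have we: "w \<in> W_even n" using w by (simp add: W_odd_def)
  obtain q where q: "q \<le> n" "w q = 0" using W_odd_zero_position[OF w] by blast
  have "w (bar n q) = 2*n+1" using W_even_bar[OF we, of q] q by (simp add: bar_def)
  moreover have "bar n q \<noteq> k" using q k by (simp add: bar_def)
  ultimately have "w k \<noteq> 2*n+1" using W_even_eq_iff[OF we, of "bar n q" k] by simp
  then show ?thesis using W_even_le[OF we, of k] k by simp
qed

lemma rank_fun_eq_Suc:
  assumes "\<And>k. k \<le> i \<Longrightarrow> w k \<le> j" shows "rank_fun w i j = i + 1"
proof -
  have "{k. k \<le> i \<and> w k \<le> j} = {..i}" using assms by auto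
  then show ?thesis by (simp add: rank_fun_def)
qed

section \<open>Isotropic flags in the hyperplane\<close>

lemma isotropic_flags_mono:
  assumes V: "V \<in> isotropic_flags scale U B m" and ij: "i \<in> {1..m}" "j \<in> {i..m}"
  shows "V i \<subseteq> V j"
proof -
  have "i \<le> j" "j \<le> m" using ij by auto
  then show ?thesis
  proof (induction j rule: dec_induct)
    case (step k)
    moreover have "V k \<subseteq> V (k + 1)"
      using V ij step by (auto simp: isotropic_flags_def)
    ultimately show ?case by auto
  qed simp
qed

context odd_symplectic
begin

text \<open>On \<open>E\<close> the two forms agree, and \<open>V (n + 1)\<close> contains every other member of the flag.\<close>

lemma isotropic_flags_E_iff:
  "V \<in> isotropic_flags scale E \<omega> (n + 1) \<longleftrightarrow>
     V \<in> isotropic_flags scale UNIV \<Omega> (n + 1) \<and> V (n + 1) \<subseteq> E"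
proof
  assume V: "V \<in> isotropic_flags scale E \<omega> (n + 1)"
  have "isotropic \<Omega> S" if "S \<subseteq> E" "isotropic \<omega> S" for S
    using that extends by (auto simp: isotropic_def subset_iff)
  with V show "V \<in> isotropic_flags scale UNIV \<Omega> (n + 1) \<and> V (n + 1) \<subseteq> E"
    by (fastforce simp: isotropic_flags_def PiE_iff)
next
  assume V: "V \<in> isotropic_flags scale UNIV \<Omega> (n + 1) \<and> V (n + 1) \<subseteq> E"
  have sub: "V i \<subseteq> E" if "i \<in> {1..n+1}" for i
    using isotropic_flags_mono[of V scale UNIV \<Omega> "n + 1" i "n + 1"] V that by auto
  have "isotropic \<omega> S" if "S \<subseteq> E" "isotropic \<Omega> S" for S
    using that extends by (auto simp: isotropic_def subset_iff)
  with V sub show "V \<in> isotropic_flags scale E \<omega> (n + 1)"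
    by (simp add: isotropic_flags_def PiE_iff)
qed

text \<open>The given basis makes the ambient space finite-dimensional, so a subspace of \<open>S\<close> with the
dimension of \<open>S\<close> is \<open>S\<close>.\<close>

lemma subset_of_dim_Int_eq:
  assumes "subspace S" "subspace T" "dim (S \<inter> T) = dim S"
  shows "S \<subseteq> T"
proof -
  interpret finite_dimensional_vector_space scale "e ` {0..2*n+1}"
    by unfold_locales (use basis_independent basis_span in auto)
  have "S \<inter> T = S"
    by (rule subspace_dim_equal) (use assms subspace_inter in auto)
  then show ?thesis by blast
qed

lemma schubert_cell_eq:
  assumes "w \<in> W_odd n"
  shows "schubert_cell scale n \<Omega> e w =
    {V \<in> isotropic_flags scale E \<omega> (n + 1).
       \<forall>i\<in>{0..n}. \<forall>j\<in>{0..2*n}. dim (V (i + 1) \<inter> std_flag scale e j) = rank_fun w i j}"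
proof (intro equalityI subsetI)
  fix V assume V: "V \<in> schubert_cell scale n \<Omega> e w"
  then have flag: "V \<in> isotropic_flags scale UNIV \<Omega> (n + 1)"
    and "dim (V (n + 1) \<inter> std_flag scale e (2*n)) = rank_fun w n (2*n)"
    by (auto simp: schubert_cell_def)
  moreover have "rank_fun w n (2*n) = n + 1"
    by (rule rank_fun_eq_Suc[OF W_odd_le[OF assms]])
  ultimately have "dim (V (n + 1) \<inter> E) = n + 1"
    by (simp add: E_eq std_flag_def)
  moreover have "subspace (V (n + 1))" "dim (V (n + 1)) = n + 1"
    using flag by (auto simp: isotropic_flags_def PiE_iff)
  ultimately have "V (n + 1) \<subseteq> E"
    using subset_of_dim_Int_eq[OF _ subspace_E] by metis
  with V flag show "V \<in> {V \<in> isotropic_flags scale E \<omega> (n + 1).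
      \<forall>i\<in>{0..n}. \<forall>j\<in>{0..2*n}. dim (V (i + 1) \<inter> std_flag scale e j) = rank_fun w i j}"
    by (simp add: isotropic_flags_E_iff[simplified] schubert_cell_def)
next
  fix V assume V: "V \<in> {V \<in> isotropic_flags scale E \<omega> (n + 1).
      \<forall>i\<in>{0..n}. \<forall>j\<in>{0..2*n}. dim (V (i + 1) \<inter> std_flag scale e j) = rank_fun w i j}"
  then have flag: "V \<in> isotropic_flags scale UNIV \<Omega> (n + 1)"
    using isotropic_flags_E_iff by blast
  have "dim (V (i + 1) \<inter> std_flag scale e j) = rank_fun w i j"
    if ij: "i \<le> n" "j \<le> 2*n+1" for i j
  proof (cases "j \<le> 2*n")
    case False
    then have "j = 2*n+1" using ij by simp
    then have "std_flag scale e j = UNIV" by (simp only: std_flag_def basis_span)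
    moreover have "dim (V (i + 1)) = i + 1" using flag ij by (auto simp: isotropic_flags_def)
    moreover have "rank_fun w i j = i + 1"
      using W_odd_le[OF assms] False ij by (intro rank_fun_eq_Suc) (meson le_trans nat_le_linear)
    ultimately show ?thesis by simp
  qed (use V ij in auto)
  with flag show "V \<in> schubert_cell scale n \<Omega> e w"
    by (simp add: schubert_cell_def)
qed

end

theorem proposition4p21:
  fixes scale :: "complex \<Rightarrow> 'a::ab_group_add \<Rightarrow> 'a"
    and n :: nat
    and E :: "'a set"
    and \<omega> \<Omega> :: "'a \<Rightarrow> 'a \<Rightarrow> complex"
    and e :: "nat \<Rightarrow> 'a"
    and w :: "nat \<Rightarrow> nat"
  assumes "odd_symplectic scale n E \<omega> \<Omega> e"
    and "w \<in> W_odd n"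
  shows "schubert_cell scale n \<Omega> e w =
    {V \<in> isotropic_flags scale E \<omega> (n + 1).
       \<forall>i\<in>{0..n}. \<forall>j\<in>{0..2*n}.
         vector_space.dim scale (V (i + 1) \<inter> std_flag scale e j) = rank_fun w i j}"
  by (rule odd_symplectic.schubert_cell_eq[OF assms])

end
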